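(* Let $\{p(\tau)\}_{\tau\in\mathbb{N}_0}$ be a probability distribution on $\mathbb{N}_0$ and let $\{(X,T)_t\}_{t\ge 0}$ be the trapped random walk with trapping time distribution $p$, started at the origin, i.e. $\mathbb{P}((X,T)_0=(z,\tau))=p(\tau)$ if $z=0$ and $=0$ otherwise. Let $\sigma_t^2:=\mathbb{E}(X_t^2)$. Suppose that $p(\tau)=(\tau+1)^{-q}\,g(\tau)$ for all $\tau\in\mathbb{N}_0$, with $1<q\leq 2$ and $\tau\mapsto g(\tau)$ varying slower than any power-law. Then there exists a function $\tau\mapsto h(\tau)$, varying slower than any power-law, such that $\sigma_t^2=h(t)\,t^{q-1}$ for all $t\in\mathbb{N}$.
   Context: $\mathbb{N}_0=\{0,1,2,\dots\}$, $\mathbb{N}=\{1,2,\dots\}$. A strictly positive function $g$ of an integer variable varies slower than any power-law if $\lim_{t\to\infty}g(t)\,t^{-\epsilon}=0$ and $\lim_{t\to\infty}g(t)\,t^{\epsilon}=\infty$ for every $\epsilon>0$. Trapped random walk with trapping time distribution $p$: the discrete-time Markov chain $(X,T)_t=(X_t,T_t)$ on $\mathbb{Z}\times\mathbb{N}_0$ with transition probabilities $$\mathbb{P}((X,T)_{t+1}=(z',\tau')\mid (X,T)_t=(z,\tau))=\begin{cases}p(\tau')/2 & \text{if } |z-z'|=1 \text{ and } \tau=0,\\ 1 & \text{if } z=z' \text{ and } \tau'=\tau-1\geq 0,\\ 0&\text{otherwise.}\end{cases}$$ $X_t$ is the position and $T_t$ the remaining trapping time. $\sigma_t^2=\mathbb{E}(X_t^2)$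 is the mean squared displacement. *)

theory Defs
  imports "HOL-Probability.Probability"
begin

definition slower_than_power_law :: "(nat \<Rightarrow> real) \<Rightarrow> bool" where
  "slower_than_power_law g \<longleftrightarrow>
     (\<forall>t. g t > 0) \<and>
     (\<forall>\<epsilon>>0. ((\<lambda>t. g t * real t powr (- \<epsilon>)) \<longlonglongrightarrow> 0) \<and>
             filterlim (\<lambda>t. g t * real t powr \<epsilon>) at_top sequentially)"

text \<open>The usual elementary Markov property: conditionally on any history of positive probability,
  the law of the next state is given by the transition probabilities from the last state.\<close>

definition markov_chain ::
  "'w measure \<Rightarrow> ('s \<Rightarrow> real) \<Rightarrow> ('s \<Rightarrow> 's \<Rightarrow> real) \<Rightarrow> (nat \<Rightarrow> 'w \<Rightarrow> 's) \<Rightarrow> bool" where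
  "markov_chain M \<mu> K Y \<longleftrightarrow>
     prob_space M \<and>
     (\<forall>t. Y t \<in> measurable M (count_space UNIV)) \<and>
     (\<forall>s. \<P>(\<omega> in M. Y 0 \<omega> = s) = \<mu> s) \<and>
     (\<forall>t x s'. \<P>(\<omega> in M. \<forall>i\<le>t. Y i \<omega> = x i) > 0 \<longrightarrow>
        \<P>(\<omega> in M. Y (t + 1) \<omega> = s' \<bar> \<forall>i\<le>t. Y i \<omega> = x i) = K (x t) s')"

fun trw_trans :: "nat pmf \<Rightarrow> int \<times> nat \<Rightarrow> int \<times> nat \<Rightarrow> real" where
  "trw_trans p (z, \<tau>) (z', \<tau>') =
     (if \<bar>z - z'\<bar> = 1 \<and> \<tau> = 0 then pmf p \<tau>' / 2
      else if z = z' \<and> \<tau> \<ge> 1 \<and> \<tau>' = \<tau> - 1 then 1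
      else 0)"

fun trw_init :: "nat pmf \<Rightarrow> int \<times> nat \<Rightarrow> real" where
  "trw_init p (z, \<tau>) = (if z = 0 then pmf p \<tau> else 0)"

definition trapped_random_walk ::
  "'w measure \<Rightarrow> nat pmf \<Rightarrow> (nat \<Rightarrow> 'w \<Rightarrow> int) \<Rightarrow> (nat \<Rightarrow> 'w \<Rightarrow> nat) \<Rightarrow> bool" where
  "trapped_random_walk M p X T \<longleftrightarrow>
     markov_chain M (trw_init p) (trw_trans p) (\<lambda>t \<omega>. (X t \<omega>, T t \<omega>))"

text \<open>For a trapped random walk \<open>\<bar>X t\<bar> \<le> t\<close> almost surely, so the integral below exists.\<close>

definition mean_squared_displacement :: "'w measure \<Rightarrow> (nat \<Rightarrow> 'w \<Rightarrow> int) \<Rightarrow> nat \<Rightarrow> real" where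
  "mean_squared_displacement M X t = prob_space.expectation M (\<lambda>\<omega>. (real_of_int (X t \<omega>))\<^sup>2)"

end

theory Submission
  imports Defs
begin

text \<open>The cross term in \<open>E(X\<^sub>t\<^sub>+\<^sub>1\<^sup>2)\<close> vanishes by symmetry, so \<open>\<sigma>\<^sub>t\<^sup>2\<close> is the expected number
  of jumps before time \<open>t\<close>, i.e. \<open>\<Sum>s<t. u s\<close> with \<open>u s = P(T\<^sub>s = 0)\<close>. Jumps are renewals: with
  \<open>F j = P(\<tau> \<ge> j)\<close> one has \<open>F t + (\<Sum>s<t. u s * F (t - 1 - s)) = 1\<close>. Summing this over time and using
  that \<open>a t = (\<Sum>j<t. F j)\<close> is increasing gives \<open>p 0 * t \<le> \<sigma>\<^sub>t\<^sup>2 * a t \<le> 2 * t\<close>, so the claim reduces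
  to showing that \<open>a t\<close> is \<open>t\<^sup>2\<^sup>-\<^sup>q\<close> up to factors \<open>t\<^sup>\<plusminus>\<^sup>\<epsilon>\<close>. The lower bound comes from the terms
  \<open>t \<le> k < 2 * t\<close> of \<open>p\<close>; the upper one from \<open>a t = E(min (\<tau> + 1) t) \<le> t\<^sup>1\<^sup>-\<^sup>b * E((\<tau> + 1)\<^sup>b)\<close>,
  where the moment is finite for every \<open>b < q - 1\<close>.\<close>

section \<open>The law of the walk and the renewal equation\<close>

lemma emeasure_partition_countable:
  fixes Z :: "'w \<Rightarrow> 'b::countable"
  assumes Z[measurable]: "Z \<in> measurable M (count_space UNIV)" and A[measurable]: "A \<in> sets M"
  shows "emeasure M A = (\<integral>\<^sup>+z. emeasure M {\<omega>\<in>A. Z \<omega> = z} \<partial>count_space UNIV)"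
proof -
  have "(\<Union>z. {\<omega>\<in>A. Z \<omega> = z}) = A" by auto
  moreover have "{\<omega>\<in>A. Z \<omega> = z} \<in> sets M" for z
  proof -
    have "{\<omega>\<in>A. Z \<omega> = z} = A \<inter> {\<omega>\<in>space M. Z \<omega> = z}"
      using sets.sets_into_space[OF A] by auto
    then show ?thesis by simp
  qed
  ultimately show ?thesis
    using emeasure_UN_countable[of UNIV "\<lambda>z. {\<omega>\<in>A. Z \<omega> = z}" M]
    by (auto simp: disjoint_family_on_def)
qed

text \<open>The Markov property is given only for complete histories of positive probability.
  Splitting both events according to the whole history and summing leaves conditioning on the
  present state alone. Countability of the state space makes the set of histories countable.\<close>

lemma markov_chain_step:
  fixes Y :: "nat \<Rightarrow> 'w \<Rightarrow> 's::countable"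
  assumes "markov_chain M \<mu> K Y" and K: "K s s' \<ge> 0"
  shows "emeasure M {\<omega>\<in>space M. Y (Suc t) \<omega> = s' \<and> Y t \<omega> = s}
           = ennreal (K s s') * emeasure M {\<omega>\<in>space M. Y t \<omega> = s}"
proof -
  have "prob_space M" using assms(1) by (simp add: markov_chain_def)
  then interpret prob_space M .
  have Y[measurable]: "Y t \<in> measurable M (count_space UNIV)" for t
    using assms(1) by (simp add: markov_chain_def)
  have cond: "\<P>(\<omega> in M. Y (Suc t) \<omega> = s' \<bar> \<forall>i\<le>t. Y i \<omega> = x i) = K (x t) s'"
    if "\<P>(\<omega> in M. \<forall>i\<le>t. Y i \<omega> = x i) > 0" for x
    using assms(1) that unfolding markov_chain_def Suc_eq_plus1 by blast
  \<comment> \<open>The history up to time \<open>t\<close> is stored as a list, hence as a random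
    variable with values in a countable type.\<close>
  define H where "H = (\<lambda>\<omega>. map (\<lambda>i. Y i \<omega>) [0..<Suc t])"
  have H_eq: "H \<omega> = l \<longleftrightarrow> length l = Suc t \<and> (\<forall>i\<le>t. Y i \<omega> = l ! i)" for \<omega> l
  proof -
    have len: "length (H \<omega>) = Suc t" by (simp add: H_def)
    have nth: "H \<omega> ! i = Y i \<omega>" if "i \<le> t" for i
      using that by (simp add: H_def less_Suc_eq_le del: upt_Suc)
    show ?thesis unfolding list_eq_iff_nth_eq len less_Suc_eq_le using nth by metis
  qed
  have H[measurable]: "H \<in> measurable M (count_space UNIV)"
  proof (rule measurable_count_space_eq2_countable[THEN iffD2], intro conjI ballI)
    fix l
    have "H -` {l} \<inter> space M = {\<omega>\<in>space M. length l = Suc t \<and> (\<forall>i\<le>t. Y i \<omega> = l ! i)}"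
      unfolding H_eq[symmetric] by auto
    also have "\<dots> \<in> sets M" by measurable
    finally show "H -` {l} \<inter> space M \<in> sets M" .
  qed auto
  let ?A = "{\<omega>\<in>space M. Y (Suc t) \<omega> = s' \<and> Y t \<omega> = s}" and ?B = "{\<omega>\<in>space M. Y t \<omega> = s}"
  have piece: "emeasure M {\<omega>\<in>?A. H \<omega> = l} = ennreal (K s s') * emeasure M {\<omega>\<in>?B. H \<omega> = l}" for l
  proof (cases "length l = Suc t \<and> l ! t = s")
    case False
    then have "{\<omega>\<in>?A. H \<omega> = l} = {}" "{\<omega>\<in>?B. H \<omega> = l} = {}" unfolding H_eq by auto
    then show ?thesis by (simp only: emeasure_empty mult_zero_right)
  next
    case True
    let ?h = "\<P>(\<omega> in M. \<forall>i\<le>t. Y i \<omega> = l ! i)"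
    have A: "{\<omega>\<in>?A. H \<omega> = l} = {\<omega>\<in>space M. Y (Suc t) \<omega> = s' \<and> (\<forall>i\<le>t. Y i \<omega> = l ! i)}"
      and B: "{\<omega>\<in>?B. H \<omega> = l} = {\<omega>\<in>space M. \<forall>i\<le>t. Y i \<omega> = l ! i}"
      unfolding H_eq using True by auto
    have "\<P>(\<omega> in M. Y (Suc t) \<omega> = s' \<and> (\<forall>i\<le>t. Y i \<omega> = l ! i)) = K s s' * ?h"
    proof (cases "?h > 0")
      case pos: True
      then show ?thesis using cond[OF pos] True by (simp add: cond_prob_def field_simps)
    next
      \<comment> \<open>For a null history the conditional probability says nothing, but both sides
        are 0.\<close>
      case False
      have "\<P>(\<omega> in M. Y (Suc t) \<omega> = s' \<and> (\<forall>i\<le>t. Y i \<omega> = l ! i)) \<le> ?h"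
        by (rule finite_measure_mono) auto
      moreover have "?h = 0" using False measure_nonneg[of M] by (meson antisym_conv not_le)
      ultimately show ?thesis by (simp add: measure_le_0_iff)
    qed
    then show ?thesis unfolding A B by (simp add: emeasure_eq_measure ennreal_mult K)
  qed
  have "emeasure M ?A = (\<integral>\<^sup>+l. emeasure M {\<omega>\<in>?A. H \<omega> = l} \<partial>count_space UNIV)"
    by (rule emeasure_partition_countable) measurable
  also have "\<dots> = ennreal (K s s') * (\<integral>\<^sup>+l. emeasure M {\<omega>\<in>?B. H \<omega> = l} \<partial>count_space UNIV)"
    unfolding piece by (rule nn_integral_cmult) simp
  also have "(\<integral>\<^sup>+l. emeasure M {\<omega>\<in>?B. H \<omega> = l} \<partial>count_space UNIV) = emeasure M ?B"
    by (rule emeasure_partition_countable[symmetric]) measurable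
  finally show ?thesis .
qed

text \<open>Splitting by the previous state turns the one-step identity into the mass formula of
  \<open>bind_pmf\<close>; atoms then determine the law. From here on everything about a fixed time
  can be computed in the pmf monad.\<close>

lemma markov_chain_distr:
  fixes Y :: "nat \<Rightarrow> 'w \<Rightarrow> 's::countable"
  assumes mc: "markov_chain M (pmf \<mu>) (\<lambda>s. pmf (\<kappa> s)) Y"
  shows "distr M (count_space UNIV) (Y t) = measure_pmf (((\<lambda>\<nu>. bind_pmf \<nu> \<kappa>) ^^ t) \<mu>)"
proof -
  have "prob_space M" using mc by (simp add: markov_chain_def)
  then interpret prob_space M .
  have Y[measurable]: "Y t \<in> measurable M (count_space UNIV)" for t
    using mc by (simp add: markov_chain_def)
  have law: "emeasure M {\<omega>\<in>space M. Y t \<omega> = s} = ennreal (pmf (((\<lambda>\<nu>. bind_pmf \<nu> \<kappa>) ^^ t) \<mu>) s)" for s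
  proof (induction t arbitrary: s)
    case 0
    then show ?case using mc by (simp add: markov_chain_def emeasure_eq_measure)
  next
    case (Suc t)
    let ?L = "((\<lambda>\<nu>. bind_pmf \<nu> \<kappa>) ^^ t) \<mu>"
    have "emeasure M {\<omega>\<in>space M. Y (Suc t) \<omega> = s}
        = (\<integral>\<^sup>+x. emeasure M {\<omega>\<in>{\<omega>\<in>space M. Y (Suc t) \<omega> = s}. Y t \<omega> = x} \<partial>count_space UNIV)"
      by (rule emeasure_partition_countable) measurable
    also have "\<dots> = (\<integral>\<^sup>+x. ennreal (pmf ?L x) * ennreal (pmf (\<kappa> x) s) \<partial>count_space UNIV)"
      using markov_chain_step[OF mc, of _ s t]
      by (intro nn_integral_cong) (simp add: Suc.IH mult.commute conj_assoc)
    also have "\<dots> = ennreal (pmf (bind_pmf ?L \<kappa>) s)"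
      unfolding ennreal_pmf_bind by (rule nn_integral_measure_pmf[symmetric])
    finally show ?case by simp
  qed
  show ?thesis
  proof (rule measure_eqI_countable[where A = UNIV])
    fix s
    have "Y t -` {s} \<inter> space M = {\<omega>\<in>space M. Y t \<omega> = s}" by auto
    then show "emeasure (distr M (count_space UNIV) (Y t)) {s}
        = emeasure (measure_pmf (((\<lambda>\<nu>. bind_pmf \<nu> \<kappa>) ^^ t) \<mu>)) {s}"
      by (simp add: emeasure_distr law emeasure_pmf_single)
  qed auto
qed

section \<open>The trapped walk as an iterated kernel, and its second moment\<close>

definition trw_step :: "nat pmf \<Rightarrow> int \<times> nat \<Rightarrow> (int \<times> nat) pmf" where
  "trw_step p s = (if snd s = 0
     then map_pmf (\<lambda>(b, k). (if b then fst s + 1 else fst s - 1, k)) (pair_pmf (bernoulli_pmf (1/2)) p)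
     else return_pmf (fst s, snd s - 1))"

definition trw_law :: "nat pmf \<Rightarrow> nat \<Rightarrow> (int \<times> nat) pmf" where
  "trw_law p t = ((\<lambda>\<nu>. bind_pmf \<nu> (trw_step p)) ^^ t) (map_pmf (Pair 0) p)"

lemma trw_law_0: "trw_law p 0 = map_pmf (Pair 0) p"
  and trw_law_Suc: "trw_law p (Suc t) = bind_pmf (trw_law p t) (trw_step p)"
  by (simp_all add: trw_law_def)

text \<open>At a jump, a fair coin gives the direction and an independent draw from \<open>p\<close>
  the new trapping time. The map from these two to the next state is injective, so a neighbouring
  state has a single preimage, of mass \<open>pmf p k' / 2\<close>.\<close>

lemma trw_trans_eq_pmf: "trw_trans p = (\<lambda>s. pmf (trw_step p s))"
proof (intro ext)
  fix s s' :: "int \<times> nat"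
  obtain z k z' k' where s: "s = (z, k)" "s' = (z', k')" by (metis surj_pair)
  show "trw_trans p s s' = pmf (trw_step p s) s'"
  proof (cases "k = 0")
    case True
    let ?f = "\<lambda>(b, k). (if b then z + 1 else z - 1, k :: nat)"
    have inj: "inj ?f" by (auto simp: inj_def split: if_splits)
    show ?thesis
    proof (cases "\<bar>z - z'\<bar> = 1")
      case near: True
      then have eq: "(z', k') = ?f (z' = z + 1, k')" by auto
      have "pmf (map_pmf ?f (pair_pmf (bernoulli_pmf (1/2)) p)) (z', k') = pmf p k' / 2"
        unfolding eq pmf_map_inj'[OF inj] by (simp add: pmf_pair)
      then show ?thesis unfolding s trw_step_def fst_conv snd_conv using near True by simp
    next
      case far: False
      then have "(z', k') \<notin> range ?f" by (auto split: if_splits)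
      then have "(z', k') \<notin> ?f ` set_pmf (pair_pmf (bernoulli_pmf (1/2)) p)" by blast
      from pmf_map_outside[OF this] show ?thesis unfolding s trw_step_def fst_conv snd_conv using far True by simp
    qed
  next
    case False
    then show ?thesis by (auto simp: s trw_step_def)
  qed
qed

lemma trw_init_eq_pmf: "trw_init p = pmf (map_pmf (Pair 0) p)"
proof
  fix s :: "int \<times> nat"
  obtain z k where s: "s = (z, k)" by (metis surj_pair)
  have inj: "inj (Pair (0::int) :: nat \<Rightarrow> _)" by (auto simp: inj_def)
  show "trw_init p s = pmf (map_pmf (Pair 0) p) s"
  proof (cases "z = 0")
    case True
    then show ?thesis by (simp add: s pmf_map_inj'[OF inj])
  next
    case False
    then have "s \<notin> Pair 0 ` set_pmf p" by (auto simp: s)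
    from pmf_map_outside[OF this] show ?thesis using False by (simp add: s)
  qed
qed

text \<open>The renewal probability \<open>u t\<close>: the walk moves between times
  \<open>t\<close> and \<open>t + 1\<close> exactly when its remaining trapping time at
  \<open>t\<close> is 0.\<close>

definition jump_prob :: "nat pmf \<Rightarrow> nat \<Rightarrow> real" where
  "jump_prob p t = measure (trw_law p t) {s. snd s = 0}"

text \<open>At a jump the terms \<open>2 * z\<close> and \<open>- 2 * z\<close> cancel and 1 is left
  over. The nonnegative integral allows this to be iterated before the second moment is known to be
  finite.\<close>

lemma nn_integral_trw_step:
  "(\<integral>\<^sup>+s'. ennreal ((real_of_int (fst s'))\<^sup>2) \<partial>trw_step p s)
     = ennreal ((real_of_int (fst s))\<^sup>2) + indicator {s. snd s = 0} s"
proof (cases "snd s = 0")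
  case True
  let ?z = "real_of_int (fst s)"
  have "(\<integral>\<^sup>+s'. ennreal ((real_of_int (fst s'))\<^sup>2) \<partial>trw_step p s)
      = ennreal ((?z + 1)\<^sup>2) * ennreal (1/2) + ennreal ((?z - 1)\<^sup>2) * ennreal (1 - 1/2)"
    unfolding trw_step_def if_P[OF True]
    by (simp add: nn_integral_pair_pmf' measure_pmf.emeasure_space_1)
  also have "\<dots> = ennreal ((?z + 1)\<^sup>2 * (1/2) + (?z - 1)\<^sup>2 * (1 - 1/2))"
    by (simp only: ennreal_mult ennreal_plus zero_le_power2 mult_nonneg_nonneg)
  also have "(?z + 1)\<^sup>2 * (1/2) + (?z - 1)\<^sup>2 * (1 - 1/2) = ?z\<^sup>2 + 1"
    by (simp add: power2_eq_square field_simps)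
  finally show ?thesis using True by simp
next
  case False
  then show ?thesis by (simp add: trw_step_def)
qed

lemma second_moment_trw_law:
  "(\<integral>\<^sup>+s. ennreal ((real_of_int (fst s))\<^sup>2) \<partial>trw_law p t) = ennreal (\<Sum>s<t. jump_prob p s)"
proof (induction t)
  case 0
  then show ?case by (simp add: trw_law_0)
next
  case (Suc t)
  have "(\<integral>\<^sup>+s. ennreal ((real_of_int (fst s))\<^sup>2) \<partial>trw_law p (Suc t))
      = (\<integral>\<^sup>+s. ennreal ((real_of_int (fst s))\<^sup>2) \<partial>trw_law p t)
        + emeasure (trw_law p t) {s. snd s = 0}"
    unfolding trw_law_Suc nn_integral_bind_pmf nn_integral_trw_step by (subst nn_integral_add) auto
  also have "\<dots> = ennreal (\<Sum>s<Suc t. jump_prob p s)"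
    unfolding Suc.IH by (simp add: jump_prob_def measure_pmf.emeasure_eq_measure sum_nonneg flip: ennreal_plus)
  finally show ?case .
qed

lemma mean_squared_displacement_eq:
  assumes "trapped_random_walk M p X T"
  shows "mean_squared_displacement M X t = (\<Sum>s<t. jump_prob p s)"
proof -
  have mc: "markov_chain M (pmf (map_pmf (Pair 0) p)) (\<lambda>s. pmf (trw_step p s)) (\<lambda>t \<omega>. (X t \<omega>, T t \<omega>))"
    using assms by (simp add: trapped_random_walk_def trw_trans_eq_pmf trw_init_eq_pmf)
  let ?Y = "\<lambda>\<omega>. (X t \<omega>, T t \<omega>)"
  have Y[measurable]: "?Y \<in> measurable M (count_space UNIV)"
    using mc by (simp add: markov_chain_def)
  have "(\<integral>\<^sup>+\<omega>. ennreal ((real_of_int (X t \<omega>))\<^sup>2) \<partial>M)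
      = (\<integral>\<^sup>+s. ennreal ((real_of_int (fst s))\<^sup>2) \<partial>distr M (count_space UNIV) ?Y)"
    by (subst nn_integral_distr) auto
  also have "\<dots> = ennreal (\<Sum>s<t. jump_prob p s)"
    unfolding markov_chain_distr[OF mc] trw_law_def[symmetric] by (rule second_moment_trw_law)
  finally have nn: "(\<integral>\<^sup>+\<omega>. ennreal ((real_of_int (X t \<omega>))\<^sup>2) \<partial>M) = ennreal (\<Sum>s<t. jump_prob p s)" .
  have "fst \<circ> ?Y \<in> measurable M (count_space UNIV)"
    by (rule measurable_comp[OF Y]) simp
  then have [measurable]: "X t \<in> measurable M (count_space UNIV)" by (simp add: comp_def)
  show ?thesis
    unfolding mean_squared_displacement_def
    by (subst integral_eq_nn_integral) (auto simp: nn jump_prob_def sum_nonneg)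
qed

text \<open>Renewal decomposition: either the initial trapping time has not run out by time \<open>t\<close>,
  or there is a last jump, issuing from time \<open>s\<close>.\<close>
lemma measure_trw_law_tail:
  "measure (trw_law p t) {s. snd s \<ge> j}
     = measure p {j + t..} + (\<Sum>s<t. jump_prob p s * measure p {j + (t - 1 - s)..})"
proof (induction t arbitrary: j)
  case 0
  then show ?case by (simp add: trw_law_0 vimage_def atLeast_def)
next
  case (Suc t)
  let ?S = "\<lambda>j::nat. {s :: int \<times> nat. j \<le> snd s}" and ?Z = "{s :: int \<times> nat. snd s = 0}"
  \<comment> \<open>A remaining time of at least \<open>j\<close> after a step arises in two
    exclusive ways: it was at least \<open>j + 1\<close> before, or it was 0 and the fresh trapping
    time is at least \<open>j\<close>.\<close>
  have step: "emeasure (trw_step p s) (?S j)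
      = indicator (?S (Suc j)) s + ennreal (measure p {j..}) * indicator ?Z s" for s
  proof (cases "snd s = 0")
    case True
    have "(\<lambda>x. (case x of (b, k) \<Rightarrow> (if b then fst s + 1 else fst s - 1, k))) -` ?S j
        = UNIV \<times> {j..}" by (auto split: if_splits)
    moreover have "emeasure (pair_pmf (bernoulli_pmf (1/2)) p) (UNIV \<times> {j..}) = emeasure p {j..}"
    proof -
      have "emeasure (pair_pmf (bernoulli_pmf (1/2)) p) (UNIV \<times> {j..})
          = emeasure (map_pmf snd (pair_pmf (bernoulli_pmf (1/2)) p)) {j..}"
        unfolding emeasure_map_pmf by (rule arg_cong[where f = "emeasure _"]) auto
      then show ?thesis by (simp add: map_snd_pair_pmf)
    qed
    ultimately show ?thesis using True
      by (simp add: trw_step_def measure_pmf.emeasure_eq_measure)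
  next
    case False
    then show ?thesis by (auto simp: trw_step_def indicator_def)
  qed
  have "emeasure (trw_law p (Suc t)) (?S j)
      = emeasure (trw_law p t) (?S (Suc j)) + ennreal (measure p {j..}) * emeasure (trw_law p t) ?Z"
    by (simp add: trw_law_Suc step nn_integral_add nn_integral_cmult)
  then have "measure (trw_law p (Suc t)) (?S j)
      = measure (trw_law p t) (?S (Suc j)) + measure p {j..} * jump_prob p t"
    by (simp add: measure_pmf.emeasure_eq_measure jump_prob_def flip: ennreal_mult ennreal_plus)
  also have "\<dots> = measure p {j + Suc t..}
      + (\<Sum>s<t. jump_prob p s * measure p {Suc j + (t - 1 - s)..}) + jump_prob p t * measure p {j..}"
    by (simp add: Suc.IH)
  also have "(\<Sum>s<t. jump_prob p s * measure p {Suc j + (t - 1 - s)..})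
      = (\<Sum>s<t. jump_prob p s * measure p {j + (Suc t - 1 - s)..})"
    by (intro sum.cong) (auto simp: Suc_diff_Suc)
  finally show ?case by simp
qed

section \<open>The summed renewal identity and bounds for the expected number of jumps\<close>

definition tail_sum :: "nat pmf \<Rightarrow> nat \<Rightarrow> real" where
  "tail_sum p t = (\<Sum>j<t. measure p {j..})"

lemma tail_sum_mono: "s \<le> t \<Longrightarrow> tail_sum p s \<le> tail_sum p t"
  unfolding tail_sum_def by (intro sum_mono2) auto

lemma jump_prob_nonneg: "jump_prob p t \<ge> 0"
  by (simp add: jump_prob_def)

text \<open>Passing from \<open>t\<close> to \<open>t + 1\<close> adds one tail probability to each
  \<open>tail_sum\<close>, and the added terms are the renewal decomposition at time
  \<open>t + 1\<close>, where the total probability is 1.\<close>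

lemma renewal_equation:
  "(\<Sum>s<t. jump_prob p s * tail_sum p (t - s)) = (\<Sum>n<t. 1 - measure p {Suc n..})"
proof (induction t)
  case (Suc t)
  \<comment> \<open>The event with \<open>j = 0\<close> is the whole space.\<close>
  have one: "1 = measure p {Suc t..} + (\<Sum>s<Suc t. jump_prob p s * measure p {t - s..})"
    using measure_trw_law_tail[of p "Suc t" 0] by simp
  have "(\<Sum>s<Suc t. jump_prob p s * tail_sum p (Suc t - s))
      = (\<Sum>s<Suc t. jump_prob p s * tail_sum p (t - s) + jump_prob p s * measure p {t - s..})"
    by (intro sum.cong) (auto simp: tail_sum_def Suc_diff_le algebra_simps)
  also have "\<dots> = (\<Sum>s<Suc t. jump_prob p s * tail_sum p (t - s))
      + (\<Sum>s<Suc t. jump_prob p s * measure p {t - s..})"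
    by (rule sum.distrib)
  \<comment> \<open>The extra summand \<open>s = t\<close> vanishes because
    \<open>tail_sum p 0 = 0\<close>.\<close>
  also have "(\<Sum>s<Suc t. jump_prob p s * tail_sum p (t - s)) = (\<Sum>n<t. 1 - measure p {Suc n..})"
    using Suc.IH by (simp add: tail_sum_def)
  also have "(\<Sum>s<Suc t. jump_prob p s * measure p {t - s..}) = 1 - measure p {Suc t..}"
    using one by linarith
  finally show ?case by simp
qed simp

text \<open>Each term on the right of the renewal equation is at least \<open>pmf p 0\<close>, and
  on the left every lag \<open>t - s\<close> is at most \<open>t\<close>, so monotonicity of
  \<open>tail_sum\<close> pulls out the factor \<open>tail_sum p t\<close>.\<close>

lemma sum_jump_prob_lower:
  "(\<Sum>s<t. jump_prob p s) * tail_sum p t \<ge> pmf p 0 * real t"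
proof -
  have "1 - measure p {Suc n..} \<ge> pmf p 0" for n
  proof -
    have "pmf p 0 + measure p {Suc n..} = measure p ({0} \<union> {Suc n..})"
      by (subst measure_pmf.finite_measure_Union) (auto simp: measure_pmf_single)
    then show ?thesis using measure_pmf.prob_le_1[of p "{0} \<union> {Suc n..}"] by linarith
  qed
  then have "pmf p 0 * real t \<le> (\<Sum>n<t. 1 - measure p {Suc n..})"
    using sum_bounded_below[of "{..<t}" "pmf p 0" "\<lambda>n. 1 - measure p {Suc n..}"] by (simp add: mult.commute)
  also have "\<dots> = (\<Sum>s<t. jump_prob p s * tail_sum p (t - s))"
    by (rule renewal_equation[symmetric])
  also have "\<dots> \<le> (\<Sum>s<t. jump_prob p s * tail_sum p t)"
    by (intro sum_mono mult_left_mono tail_sum_mono jump_prob_nonneg) simp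
  finally show ?thesis by (simp add: sum_distrib_right)
qed

text \<open>Here the renewal equation is used at the doubled horizon \<open>2 * t\<close>: for
  \<open>s < t\<close> the lag \<open>2 * t - s\<close> is at least \<open>t\<close>, which reverses
  the monotonicity bound at the price of the factor 2.\<close>

lemma sum_jump_prob_upper:
  "(\<Sum>s<t. jump_prob p s) * tail_sum p t \<le> 2 * real t"
proof -
  have "(\<Sum>s<t. jump_prob p s) * tail_sum p t = (\<Sum>s<t. jump_prob p s * tail_sum p t)"
    by (simp add: sum_distrib_right)
  also have "\<dots> \<le> (\<Sum>s<t. jump_prob p s * tail_sum p (2 * t - s))"
    by (intro sum_mono mult_left_mono tail_sum_mono jump_prob_nonneg) auto
  also have "\<dots> \<le> (\<Sum>s<2 * t. jump_prob p s * tail_sum p (2 * t - s))"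
    by (intro sum_mono2) (auto simp: jump_prob_nonneg tail_sum_def sum_nonneg)
  also have "\<dots> = (\<Sum>n<2 * t. 1 - measure p {Suc n..})"
    by (rule renewal_equation)
  also have "\<dots> \<le> 2 * real t"
    using sum_bounded_above[of "{..<2 * t}" "\<lambda>n. 1 - measure p {Suc n..}" 1] by simp
  finally show ?thesis .
qed

section \<open>Bounds for the truncated mean of the time between jumps\<close>

lemma tail_sum_ge:
  assumes "\<And>k. t \<le> k \<Longrightarrow> k < 2 * t \<Longrightarrow> pmf p k \<ge> c"
  shows "tail_sum p t \<ge> (real t)\<^sup>2 * c"
proof -
  \<comment> \<open>Every tail starting below \<open>t\<close> contains the whole block of
    \<open>t\<close> atoms from \<open>t\<close> to \<open>2 * t - 1\<close>; summing over the
    \<open>t\<close> such tails gives the second factor \<open>t\<close>.\<close>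
  have "real t * c \<le> measure p {j..}" if "j < t" for j
  proof -
    have "real t * c \<le> (\<Sum>k\<in>{t..<2 * t}. pmf p k)"
      using sum_bounded_below[of "{t..<2 * t}" c "pmf p"] assms by simp
    also have "\<dots> = measure p {t..<2 * t}"
      by (simp add: measure_measure_pmf_finite)
    also have "\<dots> \<le> measure p {j..}"
      using that by (intro measure_pmf.finite_measure_mono) auto
    finally show ?thesis .
  qed
  then show ?thesis unfolding tail_sum_def
    using sum_bounded_below[of "{..<t}" "real t * c" "\<lambda>j. measure p {j..}"]
    by (simp add: power2_eq_square mult.assoc)
qed

text \<open>Exactly \<open>min (k + 1) t\<close> of the indices \<open>j < t\<close> satisfy
  \<open>j \<le> k\<close>. Since two consecutive jumps are \<open>k + 1\<close> steps apart when
  the trapping time drawn is \<open>k\<close>, this is the mean gap truncated at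
  \<open>t\<close>.\<close>

lemma tail_sum_eq_expectation:
  "tail_sum p t = measure_pmf.expectation p (\<lambda>k. real (min (k + 1) t))"
proof -
  have "(\<Sum>j<t. indicator {j..} k) = real (min (k + 1) t)" for k
  proof -
    have "(\<Sum>j<t. indicator {j..} k) = (\<Sum>j<t. if j < k + 1 then 1 else (0::real))"
      by (intro sum.cong) (auto simp: indicator_def)
    also have "\<dots> = (\<Sum>j\<in>{..<t} \<inter> {j. j < k + 1}. 1)"
      by (subst sum.inter_restrict) auto
    also have "{..<t} \<inter> {j. j < k + 1} = {..<min (k + 1) t}" by auto
    finally show ?thesis by simp
  qed
  moreover have "tail_sum p t = measure_pmf.expectation p (\<lambda>k. \<Sum>j<t. indicator {j..} k)"
    by (subst Bochner_Integration.integral_sum)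
       (auto simp: tail_sum_def measure_pmf.emeasure_eq_measure intro!: sum.cong)
  ultimately show ?thesis by simp
qed

lemma tail_sum_le:
  assumes b: "0 \<le> b" "b \<le> 1"
    and int: "integrable (measure_pmf p) (\<lambda>k. (real k + 1) powr b)"
  shows "tail_sum p t \<le> real t powr (1 - b) * measure_pmf.expectation p (\<lambda>k. (real k + 1) powr b)"
proof -
  have "real (min (k + 1) t) \<le> real t powr (1 - b) * (real k + 1) powr b" for k
  proof (cases "t = 0")
    case False
    let ?m = "real (min (k + 1) t)"
    \<comment> \<open>Interpolation: the minimum is bounded by \<open>t\<close> in the first factor
      and by \<open>k + 1\<close> in the second.\<close>
    have "?m = ?m powr (1 - b) * ?m powr b"
      using False by (simp flip: powr_add)
    also have "\<dots> \<le> real t powr (1 - b) * (real k + 1) powr b"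
      using b by (intro mult_mono powr_mono2) auto
    finally show ?thesis .
  qed simp
  moreover have "integrable (measure_pmf p) (\<lambda>k. real (min (k + 1) t))"
    by (rule measure_pmf.integrable_const_bound[where B = "real t"]) auto
  ultimately have "tail_sum p t \<le> measure_pmf.expectation p (\<lambda>k. real t powr (1 - b) * (real k + 1) powr b)"
    unfolding tail_sum_eq_expectation using integrable_mult_right[OF int] by (intro integral_mono)
  then show ?thesis by simp
qed

section \<open>Power-law bounds\<close>

lemma slower_than_power_law_upper:
  assumes g: "slower_than_power_law g" and "\<epsilon> > 0"
  obtains C where "\<And>t. g t \<le> C * (real t + 1) powr \<epsilon>"
proof -
  have "(\<lambda>t. g t * real t powr (- \<epsilon>)) \<longlonglongrightarrow> 0" and pos: "\<And>t. g t > 0"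
    using assms unfolding slower_than_power_law_def by auto
  then have "Bseq (\<lambda>t. g t * real t powr (- \<epsilon>))"
    by (intro convergent_imp_Bseq) (auto simp: convergent_def)
  then obtain K where K: "K > 0" "\<And>t. norm (g t * real t powr (- \<epsilon>)) \<le> K" by (auto elim: BseqE)
  \<comment> \<open>The summand \<open>g 0\<close> covers \<open>t = 0\<close>, where
    \<open>real t powr (- \<epsilon>)\<close> is 0 and the bound \<open>K\<close> carries no
    information about \<open>g\<close>.\<close>
  have "g t \<le> (K + g 0) * (real t + 1) powr \<epsilon>" for t
  proof (cases "t = 0")
    case True
    then show ?thesis using K by simp
  next
    case False
    have "g t = norm (g t * real t powr (- \<epsilon>)) * real t powr \<epsilon>"
      using False pos[of t] by (simp add: abs_mult powr_minus)
    also have "\<dots> \<le> (K + g 0) * (real t + 1) powr \<epsilon>"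
      using K(1) K(2)[of t] pos[of 0] assms(2) by (intro mult_mono powr_mono2) auto
    finally show ?thesis .
  qed
  then show thesis by (rule that)
qed

lemma slower_than_power_law_lower:
  assumes g: "slower_than_power_law g" and "\<epsilon> > 0"
  shows "eventually (\<lambda>t. g t \<ge> real t powr (- \<epsilon>)) sequentially"
proof -
  have "filterlim (\<lambda>t. g t * real t powr \<epsilon>) at_top sequentially"
    using assms unfolding slower_than_power_law_def by auto
  then have "eventually (\<lambda>t. g t * real t powr \<epsilon> \<ge> 1) sequentially"
    by (simp add: filterlim_at_top)
  then show ?thesis using eventually_gt_at_top[of 0]
    by eventually_elim (simp add: powr_minus field_simps)
qed

text \<open>One-sided bounds with an exponent \<open>\<delta>\<close> strictly below
  \<open>\<epsilon>\<close> suffice, as the gap \<open>\<epsilon> - \<delta>\<close> absorbs the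
  constant and forces the limits.\<close>

lemma slower_than_power_lawI:
  assumes "\<And>t. h t > 0"
    and "\<And>\<epsilon>. \<epsilon> > 0 \<Longrightarrow> \<exists>C \<delta>. \<delta> < \<epsilon> \<and> eventually (\<lambda>t. h t \<le> C * real t powr \<delta>) sequentially"
    and "\<And>\<epsilon>. \<epsilon> > 0 \<Longrightarrow> \<exists>c \<delta>. c > 0 \<and> \<delta> < \<epsilon> \<and> eventually (\<lambda>t. h t \<ge> c * real t powr (- \<delta>)) sequentially"
  shows "slower_than_power_law h"
  unfolding slower_than_power_law_def
proof (intro conjI allI impI)
  show "h t > 0" for t by fact
  fix \<epsilon> :: real assume "\<epsilon> > 0"
  obtain C \<delta> where "\<delta> < \<epsilon>" and C: "eventually (\<lambda>t. h t \<le> C * real t powr \<delta>) sequentially"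
    using assms(2)[OF \<open>\<epsilon> > 0\<close>] by blast
  have lim: "(\<lambda>t. C * real t powr (\<delta> - \<epsilon>)) \<longlonglongrightarrow> 0"
    using \<open>\<delta> < \<epsilon>\<close> by (intro tendsto_mult_right_zero tendsto_neg_powr filterlim_real_sequentially) simp
  have "eventually (\<lambda>t. norm (h t * real t powr (- \<epsilon>)) \<le> C * real t powr (\<delta> - \<epsilon>)) sequentially"
    using C
  proof eventually_elim
    case (elim t)
    have "h t * real t powr (- \<epsilon>) \<le> C * real t powr \<delta> * real t powr (- \<epsilon>)"
      using elim by (intro mult_right_mono) auto
    then show ?case using assms(1)[of t] by (simp add: mult.assoc flip: powr_add)
  qed
  from this lim show "(\<lambda>t. h t * real t powr (- \<epsilon>)) \<longlonglongrightarrow> 0"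
    by (rule Lim_null_comparison)
next
  fix \<epsilon> :: real assume "\<epsilon> > 0"
  obtain c \<delta> where "c > 0" "\<delta> < \<epsilon>" and c: "eventually (\<lambda>t. h t \<ge> c * real t powr (- \<delta>)) sequentially"
    using assms(3)[OF \<open>\<epsilon> > 0\<close>] by (elim exE conjE)
  have lim: "filterlim (\<lambda>t. c * real t powr (\<epsilon> - \<delta>)) at_top sequentially"
  proof -
    have "(\<lambda>t. real t powr (\<delta> - \<epsilon>)) \<longlonglongrightarrow> 0"
      using \<open>\<delta> < \<epsilon>\<close> by (intro tendsto_neg_powr filterlim_real_sequentially) simp
    moreover have "eventually (\<lambda>t. 0 < real t powr (\<delta> - \<epsilon>)) sequentially"
      using eventually_gt_at_top[of 0] by eventually_elim simp
    ultimately have "filterlim (\<lambda>t. inverse (real t powr (\<delta> - \<epsilon>))) at_top sequentially"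
      by (rule filterlim_inverse_at_top)
    then have "filterlim (\<lambda>t. real t powr (\<epsilon> - \<delta>)) at_top sequentially"
      by (simp flip: powr_minus)
    then show ?thesis
      by (rule filterlim_tendsto_pos_mult_at_top[OF tendsto_const \<open>c > 0\<close>])
  qed
  have "eventually (\<lambda>t. c * real t powr (\<epsilon> - \<delta>) \<le> h t * real t powr \<epsilon>) sequentially"
    using c
  proof eventually_elim
    case (elim t)
    have "c * real t powr (- \<delta>) * real t powr \<epsilon> \<le> h t * real t powr \<epsilon>"
      using elim by (intro mult_right_mono) auto
    then show ?case by (simp add: mult.assoc flip: powr_add)
  qed
  with lim show "filterlim (\<lambda>t. h t * real t powr \<epsilon>) at_top sequentially"
    by (rule filterlim_at_top_mono)
qed

section \<open>Power-law estimates for the truncated mean and for the displacement\<close>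

lemma tail_sum_power_law_lower:
  assumes g: "slower_than_power_law g" and p: "\<And>k. pmf p k = (real k + 1) powr (- q) * g k"
    and "q > 0" "\<delta> > 0"
  shows "eventually (\<lambda>t. tail_sum p t \<ge> 2 powr (- q - \<delta>) * real t powr (2 - q - \<delta>)) sequentially"
proof -
  obtain N where N: "\<And>k. k \<ge> N \<Longrightarrow> g k \<ge> real k powr (- \<delta>)"
    using slower_than_power_law_lower[OF g \<open>\<delta> > 0\<close>] unfolding eventually_sequentially by blast
  have "tail_sum p t \<ge> 2 powr (- q - \<delta>) * real t powr (2 - q - \<delta>)" if t: "t \<ge> max N 1" for t
  proof -
    have "pmf p k \<ge> (2 * real t) powr (- q - \<delta>)" if k: "t \<le> k" "k < 2 * t" for k
    proof -
      \<comment> \<open>Both \<open>k + 1\<close> and \<open>k\<close> are at most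
        \<open>2 * t\<close> and both exponents are negative; \<open>t \<ge> 1\<close> keeps the
        base \<open>k\<close> positive.\<close>
      have "(2 * real t) powr (- q - \<delta>) = (2 * real t) powr (- q) * (2 * real t) powr (- \<delta>)"
        by (simp flip: powr_add)
      also have "\<dots> \<le> (real k + 1) powr (- q) * real k powr (- \<delta>)"
        using k t assms(3,4) by (intro mult_mono powr_mono2') auto
      also have "\<dots> \<le> pmf p k"
        unfolding p using k t by (intro mult_left_mono N) auto
      finally show ?thesis .
    qed
    from tail_sum_ge[OF this]
    have "tail_sum p t \<ge> (real t)\<^sup>2 * (2 * real t) powr (- q - \<delta>)" .
    also have "(real t)\<^sup>2 * (2 * real t) powr (- q - \<delta>)
        = 2 powr (- q - \<delta>) * (real t powr 2 * real t powr (- q - \<delta>))"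
      using t by (simp add: powr_mult)
    also have "real t powr 2 * real t powr (- q - \<delta>) = real t powr (2 + (- q - \<delta>))"
      by (rule powr_add[symmetric])
    also have "2 + (- q - \<delta>) = 2 - q - \<delta>" by simp
    finally show ?thesis .
  qed
  then show ?thesis unfolding eventually_sequentially by blast
qed

lemma integrable_power_law:
  assumes g: "slower_than_power_law g" and p: "\<And>k. pmf p k = (real k + 1) powr (- q) * g k"
    and "b < q - 1"
  shows "integrable (measure_pmf p) (\<lambda>k. (real k + 1) powr b)"
proof -
  \<comment> \<open>Half of the slack in \<open>b < q - 1\<close> is spent on bounding
    \<open>g\<close>; the other half leaves the summable exponent
    \<open>- 1 - \<delta>\<close>.\<close>
  define \<delta> where "\<delta> = (q - 1 - b) / 2"
  have "\<delta> > 0" using assms(3) by (simp add: \<delta>_def)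
  then obtain C where C: "\<And>t. g t \<le> C * (real t + 1) powr \<delta>"
    using slower_than_power_law_upper[OF g] by metis
  have "summable (\<lambda>k. real k powr (- 1 - \<delta>))"
    using \<open>\<delta> > 0\<close> by (simp add: summable_real_powr_iff)
  then have "summable (\<lambda>k. real (Suc k) powr (- 1 - \<delta>))"
    by (rule summable_Suc_iff[THEN iffD2])
  then have "summable (\<lambda>k. C * (real k + 1) powr (- 1 - \<delta>))"
    by (intro summable_mult) (simp add: add.commute)
  moreover have "norm (pmf p k * (real k + 1) powr b) \<le> C * (real k + 1) powr (- 1 - \<delta>)" for k
  proof -
    have "norm (pmf p k * (real k + 1) powr b) = (real k + 1) powr (b - q) * g k"
      using g unfolding slower_than_power_law_def
      by (simp add: p abs_mult less_imp_le powr_diff powr_minus field_simps)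
    also have "\<dots> \<le> (real k + 1) powr (b - q) * (C * (real k + 1) powr \<delta>)"
      by (intro mult_left_mono C) auto
    also have "\<dots> = C * (real k + 1) powr (b - q + \<delta>)"
      by (simp add: powr_add)
    also have "b - q + \<delta> = - 1 - \<delta>" by (simp add: \<delta>_def field_simps)
    finally show ?thesis .
  qed
  ultimately have "summable (\<lambda>k. norm (pmf p k * (real k + 1) powr b))"
    by (intro summable_norm_comparison_test[where g = "\<lambda>k. C * (real k + 1) powr (- 1 - \<delta>)"] exI[of _ 0] allI impI)
  then show ?thesis unfolding measure_pmf_eq_density
    by (subst integrable_density) (auto simp: integrable_count_space_nat_iff)
qed

lemma tail_sum_pos: "t \<ge> 1 \<Longrightarrow> tail_sum p t > 0"
  using tail_sum_mono[of 1 t p] by (simp add: tail_sum_def)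

text \<open>Division of \<open>2 * t\<close> by the lower bound for \<open>tail_sum\<close> leaves
  the exponent \<open>1 + (1 - q) - (2 - q - \<delta>)\<close>, so the only loss is the
  \<open>\<delta>\<close> already present there.\<close>

lemma sum_jump_prob_power_law_upper:
  assumes g: "slower_than_power_law g" and p: "\<And>k. pmf p k = (real k + 1) powr (- q) * g k"
    and "q > 0" "\<delta> > 0"
  shows "eventually (\<lambda>t. (\<Sum>s<t. jump_prob p s) * real t powr (1 - q)
           \<le> 2 / 2 powr (- q - \<delta>) * real t powr \<delta>) sequentially"
  using tail_sum_power_law_lower[OF assms] eventually_gt_at_top[of 0]
proof eventually_elim
  case (elim t)
  let ?c = "2 powr (- q - \<delta>)"
  have "(\<Sum>s<t. jump_prob p s) \<le> 2 * real t / tail_sum p t"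
    using sum_jump_prob_upper[of p t] tail_sum_pos[of t p] elim by (simp add: pos_le_divide_eq)
  also have "\<dots> \<le> 2 * real t / (?c * real t powr (2 - q - \<delta>))"
    using elim by (intro divide_left_mono mult_pos_pos tail_sum_pos) auto
  finally have "(\<Sum>s<t. jump_prob p s) * real t powr (1 - q)
      \<le> 2 * real t / (?c * real t powr (2 - q - \<delta>)) * real t powr (1 - q)"
    by (rule mult_right_mono) simp
  also have "\<dots> = 2 / ?c * (real t powr 1 * real t powr (1 - q) / real t powr (2 - q - \<delta>))"
    using elim by simp
  also have "real t powr 1 * real t powr (1 - q) / real t powr (2 - q - \<delta>)
      = real t powr (1 + (1 - q) - (2 - q - \<delta>))"
    by (simp only: powr_add powr_diff)
  also have "1 + (1 - q) - (2 - q - \<delta>) = \<delta>" by linarith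
  finally show ?case .
qed

text \<open>Division of \<open>pmf p 0 * t\<close> by the moment bound for \<open>tail_sum\<close>.
  The estimate holds for every \<open>t \<ge> 1\<close> and not just eventually, so it also yields
  strict positivity.\<close>

lemma sum_jump_prob_power_law_lower:
  assumes g: "slower_than_power_law g" and p: "\<And>k. pmf p k = (real k + 1) powr (- q) * g k"
    and q: "q \<le> 2" and \<delta>: "0 < \<delta>" "\<delta> \<le> q - 1"
  obtains c where "c > 0"
    and "\<And>t. t \<ge> 1 \<Longrightarrow> (\<Sum>s<t. jump_prob p s) * real t powr (1 - q) \<ge> c * real t powr (- \<delta>)"
proof -
  \<comment> \<open>The order of the moment lies \<open>\<delta>\<close> below the critical value
    \<open>q - 1\<close>; the bounds on \<open>\<delta>\<close> and \<open>q\<close> place it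
    between 0 and 1, as the interpolation requires.\<close>
  define b where "b = q - 1 - \<delta>"
  have b: "0 \<le> b" "b \<le> 1" "b < q - 1" using \<delta> q by (auto simp: b_def)
  define E where "E = measure_pmf.expectation p (\<lambda>k. (real k + 1) powr b)"
  have tail: "tail_sum p t \<le> real t powr (1 - b) * E" for t
    unfolding E_def by (rule tail_sum_le[OF b(1,2) integrable_power_law[OF g p b(3)]])
  have "E > 0" using tail[of 1] tail_sum_pos[of 1 p] by simp
  have p0: "pmf p 0 > 0" using g p by (simp add: slower_than_power_law_def)
  have "pmf p 0 / E * real t powr (- \<delta>) \<le> (\<Sum>s<t. jump_prob p s) * real t powr (1 - q)"
    if t: "t \<ge> 1" for t
  proof -
    have "- \<delta> = 1 + (1 - q) - (1 - b)" by (simp add: b_def)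
    then have "pmf p 0 / E * real t powr (- \<delta>) = pmf p 0 / E * real t powr (1 + (1 - q) - (1 - b))"
      by (rule arg_cong)
    also have "\<dots> = pmf p 0 * real t / (real t powr (1 - b) * E) * real t powr (1 - q)"
      unfolding powr_diff powr_add using t by simp
    also have "\<dots> \<le> pmf p 0 * real t / tail_sum p t * real t powr (1 - q)"
      using t tail[of t] \<open>E > 0\<close>
      by (intro mult_right_mono divide_left_mono mult_pos_pos tail_sum_pos) auto
    also have "\<dots> \<le> (\<Sum>s<t. jump_prob p s) * real t powr (1 - q)"
      using sum_jump_prob_lower[of p t] tail_sum_pos[OF t, of p]
      by (intro mult_right_mono) (auto simp: pos_divide_le_eq)
    finally show ?thesis .
  qed
  moreover have "pmf p 0 / E > 0" using p0 \<open>E > 0\<close> by simp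
  ultimately show thesis using that by blast
qed

theorem theorem4:
  fixes M :: "'w measure" and p :: "nat pmf"
    and X :: "nat \<Rightarrow> 'w \<Rightarrow> int" and T :: "nat \<Rightarrow> 'w \<Rightarrow> nat"
    and g :: "nat \<Rightarrow> real" and q :: real
  assumes "trapped_random_walk M p X T"
    and "1 < q" and "q \<le> 2"
    and "slower_than_power_law g"
    and "\<And>\<tau>. pmf p \<tau> = (real \<tau> + 1) powr (- q) * g \<tau>"
  shows "\<exists>h. slower_than_power_law h \<and>
           (\<forall>t\<ge>1. mean_squared_displacement M X t = h t * real t powr (q - 1))"
proof -
  define m where "m t = (\<Sum>s<t. jump_prob p s) * real t powr (1 - q)" for t
  \<comment> \<open>At \<open>t = 0\<close> the sum is empty and \<open>m 0 = 0\<close>, so a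
    positive value is put in by hand.\<close>
  define h where "h t = (if t = 0 then 1 else m t)" for t
  have "slower_than_power_law h"
  proof (rule slower_than_power_lawI)
    \<comment> \<open>The extreme choice \<open>\<delta> = q - 1\<close>, corresponding to the
      moment of order 0, is enough for positivity.\<close>
    obtain c where c: "c > 0" "\<And>t. t \<ge> 1 \<Longrightarrow> m t \<ge> c * real t powr (- (q - 1))"
      using sum_jump_prob_power_law_lower[OF assms(4,5) \<open>q \<le> 2\<close>, of "q - 1"] \<open>1 < q\<close>
      unfolding m_def by auto
    show "h t > 0" for t
    proof (cases "t = 0")
      case False
      then have "0 < c * real t powr (- (q - 1))" using c(1) by simp
      also have "\<dots> \<le> m t" using False by (intro c(2)) simp
      finally show ?thesis using False by (simp add: h_def)
    qed (simp add: h_def)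
  next
    fix \<epsilon> :: real assume "\<epsilon> > 0"
    have "eventually (\<lambda>t. m t \<le> 2 / 2 powr (- q - \<epsilon> / 2) * real t powr (\<epsilon> / 2)) sequentially"
      unfolding m_def using \<open>\<epsilon> > 0\<close> \<open>1 < q\<close> by (intro sum_jump_prob_power_law_upper[OF assms(4,5)]) auto
    then have "eventually (\<lambda>t. h t \<le> 2 / 2 powr (- q - \<epsilon> / 2) * real t powr (\<epsilon> / 2)) sequentially"
      using eventually_gt_at_top[of 0] by eventually_elim (simp add: h_def)
    moreover have "\<epsilon> / 2 < \<epsilon>" using \<open>\<epsilon> > 0\<close> by simp
    ultimately show "\<exists>C \<delta>. \<delta> < \<epsilon> \<and> eventually (\<lambda>t. h t \<le> C * real t powr \<delta>) sequentially" by blast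
  next
    fix \<epsilon> :: real assume "\<epsilon> > 0"
    \<comment> \<open>The cap at \<open>q - 1\<close> keeps the moment order nonnegative when
      \<open>\<epsilon>\<close> is large.\<close>
    define \<delta> where "\<delta> = min (\<epsilon> / 2) (q - 1)"
    have \<delta>: "0 < \<delta>" "\<delta> < \<epsilon>" "\<delta> \<le> q - 1" using \<open>\<epsilon> > 0\<close> \<open>1 < q\<close> by (auto simp: \<delta>_def)
    obtain c where c: "c > 0" "\<And>t. t \<ge> 1 \<Longrightarrow> m t \<ge> c * real t powr (- \<delta>)"
      using sum_jump_prob_power_law_lower[OF assms(4,5) \<open>q \<le> 2\<close> \<delta>(1,3)] unfolding m_def by auto
    have "eventually (\<lambda>t. h t \<ge> c * real t powr (- \<delta>)) sequentially"
      using eventually_ge_at_top[of 1]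
    proof eventually_elim
      case (elim t)
      then show ?case using c(2)[OF elim] by (simp add: h_def)
    qed
    then show "\<exists>c \<delta>. c > 0 \<and> \<delta> < \<epsilon> \<and> eventually (\<lambda>t. h t \<ge> c * real t powr (- \<delta>)) sequentially"
      using c(1) \<delta>(2) by blast
  qed
  moreover have "mean_squared_displacement M X t = h t * real t powr (q - 1)" if "t \<ge> 1" for t
    unfolding mean_squared_displacement_eq[OF assms(1)] using that
    by (simp add: h_def m_def mult.assoc flip: powr_add)
  ultimately show ?thesis by blast
qed

end
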